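(* Let $(y,\lambda)\in\Gamma(\mathcal{U}_0,Y)\times\mathrm{Map}(\mathcal{U},\mathfrak{g}^* )$, $y_{ij}=(u_{ij},v_{ij})$, be a section-mapping with $y$ admissible, i.e. $u_{ij}v_{i+1\,j}u_{i\,j+1}^{-1}v_{ij}^{-1}=e$ for all $(i,j)\in\mathcal{U}$, and suppose that $(y,\lambda)$ is a solution, at the interior vertices $(i,j)\in\operatorname{int}\mathcal{U}$, of the equations $$\begin{cases}(R_{u_{ij}})^*\big(d\ell(\cdot,v_{ij})\big)+\lambda_{\Delta_{ij}}-\mathrm{Ad}^*_{v_{i\,j-1}}\lambda_{\Delta_{i\,j-1}}=0\\ (R_{v_{ij}})^*\big(d\ell(u_{ij},\cdot)\big)-\lambda_{\Delta_{ij}}+\mathrm{Ad}^*_{u_{i-1\,j}}\lambda_{\Delta_{i-1\,j}}=0\end{cases}$$ of the Lagrange problem with Lagrangian density $\ell:Y\to\mathbb{R}$ and constraint morphism $\Phi$ given by $\Phi_{ij}=u_{ij}v_{i+1\,j}u_{i\,j+1}^{-1}v_{ij}^{-1}$. Then its component $y$ is a solution of the discrete Euler–Poincaré equations $$R^*_{u_{ij}}\big(d\ell(\cdot,v_{ij})\big)_e-L^*_{u_{i-1\,j}}\big(d\ell(\cdot,v_{i-1\,j})\big)_e+R^*_{v_{ij}}\big(d\ell(u_{ij},\cdot)\big)_e-L^*_{v_{i\,j-1}}\big(d\ell(u_{i\,j-1},\cdot)\big)_e=0$$ at the interior vertices $(i,j)\in\operatorname{int}\mathcal{U}$.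
   Context: Consider the simplicial complex with vertices $V_0=\mathbb{Z}\times\mathbb{Z}$ and faces $\Delta_{ij}=[(i,j),(i+1,j),(i,j+1)]$, $i,j\in\mathbb{Z}$; faces are identified with vertices by $\Delta_{ij}\mapsto(i,j)$. Let $\mathcal{U}\subset\mathbb{Z}\times\mathbb{Z}$ be a finite set, identified with the finite set of faces $\{\Delta_{ij}:(i,j)\in\mathcal{U}\}$, and let $\mathcal{U}_0$ be the set of vertices of these faces. A vertex $(i,j)$ is interior, $(i,j)\in\operatorname{int}\mathcal{U}$, if the three faces having it as a vertex, $\Delta_{ij},\Delta_{i-1\,j},\Delta_{i\,j-1}$, all belong to this set of faces. $G$ is a Lie group with identity $e$, Lie algebra $\mathfrak{g}$ and dual $\mathfrak{g}^*$. Let $P=G\times V_0\to V_0$ be the trivial principal bundle, with $1$-jet bundle $J^1P=G\times G\times G\times V_0$ (the fiber over $(i,j)$ consisting of triples $(g_{ij},g_{i+1\,j},g_{i\,j+1})$), on which $G$ acts diagonally by left multiplication. The quotient $J^1P/G$ is identified with $Y=G\times G\times V_0\to V_0$ through $(g_{ij},g_{i+1\,j},g_{i\,j+1})\mapsto(u_{ij}=g_{ij}^{-1}g_{i+1\,j},\,v_{ij}=g_{ij}^{-1}g_{i\,j+1})$. A section $y\in\Gamma(\mathcal{U}_0,Y)$ assigns to each $(i,j)\in\mathcal{U}_0$ a pair $y_{ij}=(u_{ij},v_{ij})\in G\times G$. The Lagrangian density $\ell:Y=J^1P/G\to\mathbb{R}$ (a family of smooth functions on $G\times G$ indexed by the vertices)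 is the projection of a $G$-invariant Lagrangian density on $J^1P$. In an expression such as $\ell(\cdot,v_{ij})$ or $\ell(u_{ij},\cdot)$ the function $\ell$ over the vertex $(i,j)$ is meant. The constraint morphism $\Phi:J^1Y\to G$ is defined on the $1$-jet bundle $J^1Y$ of $Y$, whose fiber over the face $\Delta_{ij}$ is the product of the fibers of $Y$ over its three vertices. $L_g$ and $R_g$ are left and right translations in $G$. $R^*_{u_{ij}}(d\ell(\cdot,v_{ij}))\in\mathfrak{g}^*$ (also written with subscript $e$) denotes the pull-back to $T_eG=\mathfrak{g}$ by $R_{u_{ij}}$ of the differential at $u_{ij}$ of $u\mapsto\ell(u,v_{ij})$; likewise $R^*_{v_{ij}}(d\ell(u_{ij},\cdot))$ pulls back the differential at $v_{ij}$ of $v\mapsto\ell(u_{ij},v)$, and $L^*_{u_{i-1\,j}}(d\ell(\cdot,v_{i-1\,j}))$, $L^*_{v_{i\,j-1}}(d\ell(u_{i\,j-1},\cdot))$ use left translations and the differentials at $u_{i-1\,j}$, $v_{i\,j-1}$ respectively. $\mathrm{Ad}^*_g:\mathfrak{g}^*\to\mathfrak{g}^*$ is the transpose of $\mathrm{Ad}_g$, $(\mathrm{Ad}_g^*\mu)(\xi)=\mu(\mathrm{Ad}_g\xi)$. For $\lambda\in\mathrm{Map}(\mathcal{U},\mathfrak{g}^* )$, $\lambda_{\Delta_{ij}}$ is the value of $\lambda$ at $(i,j)\equiv\Delta_{ij}$.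
   Formalization: The Euler–Poincaré equations are asserted only at interior vertices (i,j) for which (i-1,j) and (i,j-1) are also interior; at other interior vertices the claim fails, e.g. G=ℝ, ℓ=(u²+v²)/2, U={(0,0),(-1,0),(0,-1)}. *)

theory Defs
  imports "HOL-Analysis.Analysis" "HOL-Algebra.Group"
begin

section \<open>Smooth manifolds and Lie groups\<close>

text \<open>The \<open>k\<close>-fold continuous differentiability of a map on an open subset \<open>S\<close> of a
  finite-dimensional space, through iterated directional derivatives.\<close>

primrec Ck_on :: "nat \<Rightarrow> 'a::real_normed_vector set \<Rightarrow> ('a \<Rightarrow> 'b::real_normed_vector) \<Rightarrow> bool" where
  "Ck_on 0 S f \<longleftrightarrow> continuous_on S f"
| "Ck_on (Suc k) S f \<longleftrightarrow>
     (\<forall>x\<in>S. f differentiable (at x)) \<and> (\<forall>v. Ck_on k S (\<lambda>x. frechet_derivative f (at x) v))"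

definition smooth_on :: "'a::real_normed_vector set \<Rightarrow> ('a \<Rightarrow> 'b::real_normed_vector) \<Rightarrow> bool" where
  "smooth_on S f \<longleftrightarrow> (\<forall>k. Ck_on k S f)"

text \<open>A chart is a pair \<open>(D, \<phi>)\<close> of its domain and its coordinate map; \<open>\<phi>\<close> is irrelevant
  outside \<open>D\<close>. The atlas need not be maximal.\<close>

record ('p, 'e) manifold =
  topol :: "'p topology"
  atlas :: "('p set \<times> ('p \<Rightarrow> 'e)) set"

abbreviation points :: "('p, 'e) manifold \<Rightarrow> 'p set" where
  "points M \<equiv> topspace (topol M)"

text \<open>The model space \<open>'e\<close> is an inner product space with a finite orthonormal basis. This is used
  instead of the class \<^class>\<open>euclidean_space\<close> because that class excludes dimension \<open>0\<close>.\<close>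

definition smooth_manifold :: "('p, 'e::real_inner) manifold \<Rightarrow> bool" where
  "smooth_manifold M \<longleftrightarrow>
     (\<exists>B::'e set. finite B \<and> (\<forall>b\<in>B. \<forall>c\<in>B. b \<bullet> c = (if b = c then 1 else 0)) \<and> span B = UNIV) \<and>
     Hausdorff_space (topol M) \<and> second_countable (topol M) \<and>
     (\<Union>(D, \<phi>)\<in>atlas M. D) = points M \<and>
     (\<forall>(D, \<phi>)\<in>atlas M. openin (topol M) D \<and> open (\<phi> ` D) \<and>
        homeomorphic_map (subtopology (topol M) D) (top_of_set (\<phi> ` D)) \<phi>) \<and>
     (\<forall>(D, \<phi>)\<in>atlas M. \<forall>(E, \<psi>)\<in>atlas M. smooth_on (\<phi> ` (D \<inter> E)) (\<psi> \<circ> inv_into D \<phi>))"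

definition prod_manifold ::
  "('p, 'e) manifold \<Rightarrow> ('q, 'f) manifold \<Rightarrow> ('p \<times> 'q, 'e \<times> 'f) manifold" where
  "prod_manifold M N =
     \<lparr>topol = prod_topology (topol M) (topol N),
      atlas = {(D \<times> E, map_prod \<phi> \<psi>) | D \<phi> E \<psi>. (D, \<phi>) \<in> atlas M \<and> (E, \<psi>) \<in> atlas N}\<rparr>"

definition smooth_map ::
  "('p, 'e::real_inner) manifold \<Rightarrow> ('q, 'f::real_inner) manifold \<Rightarrow> ('p \<Rightarrow> 'q) \<Rightarrow> bool" where
  "smooth_map M N F \<longleftrightarrow> continuous_map (topol M) (topol N) F \<and>
     (\<forall>(D, \<phi>)\<in>atlas M. \<forall>(E, \<psi>)\<in>atlas N.
        smooth_on (\<phi> ` (D \<inter> F -` E)) (\<psi> \<circ> F \<circ> inv_into D \<phi>))"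

definition lie_group :: "('g, 'm) monoid_scheme \<Rightarrow> ('g, 'e::real_inner) manifold \<Rightarrow> bool" where
  "lie_group G M \<longleftrightarrow> group G \<and> smooth_manifold M \<and> points M = carrier G \<and>
     smooth_map (prod_manifold M M) M (\<lambda>(x, y). x \<otimes>\<^bsub>G\<^esub> y) \<and>
     smooth_map M M (\<lambda>x. inv\<^bsub>G\<^esub> x)"

section \<open>Tangent spaces, differentials and pull-backs\<close>

text \<open>The real-valued smooth functions on \<open>M\<close>, being functions on the set \<open>points M\<close>, are
  represented by extensional functions. Tangent vectors at \<open>p\<close> are the derivations at \<open>p\<close> of the
  algebra of these functions.\<close>

definition smooth_functions :: "('p, 'e::real_inner) manifold \<Rightarrow> ('p \<Rightarrow> real) set" where
  "smooth_functions M =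
     {f \<in> extensional (points M). \<forall>(D, \<phi>)\<in>atlas M. smooth_on (\<phi> ` D) (f \<circ> inv_into D \<phi>)}"

definition tangent_space ::
  "('p, 'e::real_inner) manifold \<Rightarrow> 'p \<Rightarrow> (('p \<Rightarrow> real) \<Rightarrow> real) set" where
  "tangent_space M p = {X \<in> extensional (smooth_functions M).
     (\<forall>f\<in>smooth_functions M. \<forall>h\<in>smooth_functions M. X (\<lambda>x\<in>points M. f x + h x) = X f + X h) \<and>
     (\<forall>c. \<forall>f\<in>smooth_functions M. X (\<lambda>x\<in>points M. c * f x) = c * X f) \<and>
     (\<forall>f\<in>smooth_functions M. \<forall>h\<in>smooth_functions M.
        X (\<lambda>x\<in>points M. f x * h x) = f p * X h + X f * h p)}"

definition cotangent_space ::
  "('p, 'e::real_inner) manifold \<Rightarrow> 'p \<Rightarrow> ((('p \<Rightarrow> real) \<Rightarrow> real) \<Rightarrow> real) set" where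
  "cotangent_space M p = {\<mu> \<in> extensional (tangent_space M p).
     (\<forall>X\<in>tangent_space M p. \<forall>Y\<in>tangent_space M p.
        \<mu> (\<lambda>f\<in>smooth_functions M. X f + Y f) = \<mu> X + \<mu> Y) \<and>
     (\<forall>c. \<forall>X\<in>tangent_space M p. \<mu> (\<lambda>f\<in>smooth_functions M. c * X f) = c * \<mu> X)}"

definition differential ::
  "('p, 'e::real_inner) manifold \<Rightarrow> ('p \<Rightarrow> real) \<Rightarrow> 'p \<Rightarrow> (('p \<Rightarrow> real) \<Rightarrow> real) \<Rightarrow> real" where
  "differential M f p = (\<lambda>X\<in>tangent_space M p. X f)"

definition pushforward ::
  "('p, 'e::real_inner) manifold \<Rightarrow> ('q, 'f::real_inner) manifold \<Rightarrow> ('p \<Rightarrow> 'q) \<Rightarrow>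
   (('p \<Rightarrow> real) \<Rightarrow> real) \<Rightarrow> (('q \<Rightarrow> real) \<Rightarrow> real)" where
  "pushforward M N F X = (\<lambda>f\<in>smooth_functions N. X (\<lambda>x\<in>points M. f (F x)))"

text \<open>The pull-back to the cotangent space at \<open>p\<close> of a covector \<open>\<alpha>\<close> at \<open>F p\<close>.\<close>

definition pullback ::
  "('p, 'e::real_inner) manifold \<Rightarrow> ('q, 'f::real_inner) manifold \<Rightarrow> ('p \<Rightarrow> 'q) \<Rightarrow> 'p \<Rightarrow>
   ((('q \<Rightarrow> real) \<Rightarrow> real) \<Rightarrow> real) \<Rightarrow> ((('p \<Rightarrow> real) \<Rightarrow> real) \<Rightarrow> real)" where
  "pullback M N F p \<alpha> = (\<lambda>X\<in>tangent_space M p. \<alpha> (pushforward M N F X))"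

section \<open>The Lie algebra, its dual and the coadjoint operators\<close>

abbreviation lie_algebra ::
  "('g, 'm) monoid_scheme \<Rightarrow> ('g, 'e::real_inner) manifold \<Rightarrow> (('g \<Rightarrow> real) \<Rightarrow> real) set" where
  "lie_algebra G M \<equiv> tangent_space M \<one>\<^bsub>G\<^esub>"

abbreviation lie_coalgebra ::
  "('g, 'm) monoid_scheme \<Rightarrow> ('g, 'e::real_inner) manifold \<Rightarrow> ((('g \<Rightarrow> real) \<Rightarrow> real) \<Rightarrow> real) set" where
  "lie_coalgebra G M \<equiv> cotangent_space M \<one>\<^bsub>G\<^esub>"

definition Ad ::
  "('g, 'm) monoid_scheme \<Rightarrow> ('g, 'e::real_inner) manifold \<Rightarrow> 'g \<Rightarrow>
   (('g \<Rightarrow> real) \<Rightarrow> real) \<Rightarrow> (('g \<Rightarrow> real) \<Rightarrow> real)" where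
  "Ad G M g = pushforward M M (\<lambda>x. g \<otimes>\<^bsub>G\<^esub> x \<otimes>\<^bsub>G\<^esub> inv\<^bsub>G\<^esub> g)"

text \<open>The transpose of \<open>Ad g\<close>, without an inverse.\<close>

definition coAd ::
  "('g, 'm) monoid_scheme \<Rightarrow> ('g, 'e::real_inner) manifold \<Rightarrow> 'g \<Rightarrow>
   ((('g \<Rightarrow> real) \<Rightarrow> real) \<Rightarrow> real) \<Rightarrow> ((('g \<Rightarrow> real) \<Rightarrow> real) \<Rightarrow> real)" where
  "coAd G M g \<mu> = (\<lambda>\<xi>\<in>lie_algebra G M. \<mu> (Ad G M g \<xi>))"

definition pull_R ::
  "('g, 'm) monoid_scheme \<Rightarrow> ('g, 'e::real_inner) manifold \<Rightarrow> 'g \<Rightarrow>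
   ((('g \<Rightarrow> real) \<Rightarrow> real) \<Rightarrow> real) \<Rightarrow> ((('g \<Rightarrow> real) \<Rightarrow> real) \<Rightarrow> real)" where
  "pull_R G M g = pullback M M (\<lambda>x. x \<otimes>\<^bsub>G\<^esub> g) \<one>\<^bsub>G\<^esub>"

definition pull_L ::
  "('g, 'm) monoid_scheme \<Rightarrow> ('g, 'e::real_inner) manifold \<Rightarrow> 'g \<Rightarrow>
   ((('g \<Rightarrow> real) \<Rightarrow> real) \<Rightarrow> real) \<Rightarrow> ((('g \<Rightarrow> real) \<Rightarrow> real) \<Rightarrow> real)" where
  "pull_L G M g = pullback M M (\<lambda>x. g \<otimes>\<^bsub>G\<^esub> x) \<one>\<^bsub>G\<^esub>"

section \<open>The discrete base, sections and the two systems of equations\<close>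

type_synonym vertex = "int \<times> int"

text \<open>The face \<open>[(i, j), (i + 1, j), (i, j + 1)]\<close> is identified with its vertex \<open>(i, j)\<close>.\<close>

definition face :: "vertex \<Rightarrow> vertex set" where
  "face = (\<lambda>(i, j). {(i, j), (i + 1, j), (i, j + 1)})"

definition vertices :: "vertex set \<Rightarrow> vertex set" where
  "vertices U = (\<Union>p\<in>U. face p)"

definition interior_vertices :: "vertex set \<Rightarrow> vertex set" where
  "interior_vertices U = {p. \<forall>q. p \<in> face q \<longrightarrow> q \<in> U}"

text \<open>Sections over \<open>V\<close> of the bundle \<open>Y\<close> with fibre \<open>G \<times> G\<close>; a value of a section is the pair
  \<open>(u, v)\<close>.\<close>

definition sections :: "('g, 'm) monoid_scheme \<Rightarrow> vertex set \<Rightarrow> (vertex \<Rightarrow> 'g \<times> 'g) set" where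
  "sections G V = V \<rightarrow>\<^sub>E carrier G \<times> carrier G"

definition jet :: "(vertex \<Rightarrow> 'a) \<Rightarrow> vertex \<Rightarrow> 'a \<times> 'a \<times> 'a" where
  "jet y = (\<lambda>(i, j). (y (i, j), y (i + 1, j), y (i, j + 1)))"

definition constraint ::
  "('g, 'm) monoid_scheme \<Rightarrow> ('g \<times> 'g) \<times> ('g \<times> 'g) \<times> ('g \<times> 'g) \<Rightarrow> 'g" where
  "constraint G = (\<lambda>((u, v), (u1, v1), (u2, v2)). u \<otimes>\<^bsub>G\<^esub> v1 \<otimes>\<^bsub>G\<^esub> inv\<^bsub>G\<^esub> u2 \<otimes>\<^bsub>G\<^esub> inv\<^bsub>G\<^esub> v)"

definition admissible ::
  "('g, 'm) monoid_scheme \<Rightarrow> vertex set \<Rightarrow> (vertex \<Rightarrow> 'g \<times> 'g) \<Rightarrow> bool" where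
  "admissible G U y \<longleftrightarrow> (\<forall>p\<in>U. constraint G (jet y p) = \<one>\<^bsub>G\<^esub>)"

text \<open>The differentials at \<open>u\<close> and \<open>v\<close> of the two partial functions of the Lagrangian over the
  vertex \<open>p\<close>, where \<open>(u, v)\<close> is the value of \<open>y\<close> at \<open>p\<close>.\<close>

definition dl_u ::
  "('g, 'e::real_inner) manifold \<Rightarrow> (vertex \<Rightarrow> 'g \<times> 'g \<Rightarrow> real) \<Rightarrow> (vertex \<Rightarrow> 'g \<times> 'g) \<Rightarrow> vertex \<Rightarrow>
   (('g \<Rightarrow> real) \<Rightarrow> real) \<Rightarrow> real" where
  "dl_u M l y p = differential M (\<lambda>a\<in>points M. l p (a, snd (y p))) (fst (y p))"

definition dl_v ::
  "('g, 'e::real_inner) manifold \<Rightarrow> (vertex \<Rightarrow> 'g \<times> 'g \<Rightarrow> real) \<Rightarrow> (vertex \<Rightarrow> 'g \<times> 'g) \<Rightarrow> vertex \<Rightarrow>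
   (('g \<Rightarrow> real) \<Rightarrow> real) \<Rightarrow> real" where
  "dl_v M l y p = differential M (\<lambda>b\<in>points M. l p (fst (y p), b)) (snd (y p))"

text \<open>Equations between elements of the dual of the Lie algebra are stated by evaluation on all
  elements of the Lie algebra.\<close>

definition lagrange_equations_at ::
  "('g, 'm) monoid_scheme \<Rightarrow> ('g, 'e::real_inner) manifold \<Rightarrow> (vertex \<Rightarrow> 'g \<times> 'g \<Rightarrow> real) \<Rightarrow>
   (vertex \<Rightarrow> 'g \<times> 'g) \<Rightarrow> (vertex \<Rightarrow> (('g \<Rightarrow> real) \<Rightarrow> real) \<Rightarrow> real) \<Rightarrow> int \<Rightarrow> int \<Rightarrow> bool" where
  "lagrange_equations_at G M l y lam i j \<longleftrightarrow>
     (\<forall>\<xi>\<in>lie_algebra G M.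
        pull_R G M (fst (y (i, j))) (dl_u M l y (i, j)) \<xi>
        + lam (i, j) \<xi> - coAd G M (snd (y (i, j - 1))) (lam (i, j - 1)) \<xi> = 0) \<and>
     (\<forall>\<xi>\<in>lie_algebra G M.
        pull_R G M (snd (y (i, j))) (dl_v M l y (i, j)) \<xi>
        - lam (i, j) \<xi> + coAd G M (fst (y (i - 1, j))) (lam (i - 1, j)) \<xi> = 0)"

definition euler_poincare_at ::
  "('g, 'm) monoid_scheme \<Rightarrow> ('g, 'e::real_inner) manifold \<Rightarrow> (vertex \<Rightarrow> 'g \<times> 'g \<Rightarrow> real) \<Rightarrow>
   (vertex \<Rightarrow> 'g \<times> 'g) \<Rightarrow> int \<Rightarrow> int \<Rightarrow> bool" where
  "euler_poincare_at G M l y i j \<longleftrightarrow>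
     (\<forall>\<xi>\<in>lie_algebra G M.
        pull_R G M (fst (y (i, j))) (dl_u M l y (i, j)) \<xi>
        - pull_L G M (fst (y (i - 1, j))) (dl_u M l y (i - 1, j)) \<xi>
        + pull_R G M (snd (y (i, j))) (dl_v M l y (i, j)) \<xi>
        - pull_L G M (snd (y (i, j - 1))) (dl_v M l y (i, j - 1)) \<xi> = 0)"

end

theory Submission
  imports Defs
begin

text \<open>At a face the admissibility condition reads \<open>u v\<^sub>1 = v u\<^sub>2\<close>. Evaluate the first equation at
  \<open>(i - 1, j)\<close> on \<open>Ad u \<xi>\<close> with \<open>u = u\<^sub>i\<^sub>-\<^sub>1\<^sub>j\<close> and the second one at \<open>(i, j - 1)\<close> on \<open>Ad v \<xi>\<close> with
  \<open>v = v\<^sub>i\<^sub>j\<^sub>-\<^sub>1\<close>: the right pull-backs become left pull-backs, and by admissibility at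
  \<open>(i - 1, j - 1)\<close> the two terms containing the multiplier of that face cancel. What remains
  expresses the multipliers left over in the sum of the two equations at \<open>(i, j)\<close>. The analytic
  input is that \<open>Ad\<close> preserves the Lie algebra, that is, that smooth functions compose with
  translations.\<close>

section \<open>Calculus of iterated differentiability\<close>

text \<open>A derivative at a point involves values in a whole neighbourhood, so openness of
  \<open>S\<close> is what carries agreement on \<open>S\<close> over to the derivatives.\<close>

lemma Ck_on_cong:
  assumes "open S" "Ck_on k S f" "\<And>x. x \<in> S \<Longrightarrow> f x = g x"
  shows "Ck_on k S g"
  using assms(2,3)
proof (induction k arbitrary: f g)
  case 0
  then show ?case using continuous_on_cong by force
next
  case (Suc k)
  have der: "(g has_derivative frechet_derivative f (at x)) (at x)" if "x \<in> S" for x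
  proof (rule has_derivative_transform_within_open[OF _ assms(1) that])
    show "(f has_derivative frechet_derivative f (at x)) (at x)"
      using Suc.prems(1) that by (simp add: frechet_derivative_works)
  qed (use Suc.prems(2) in auto)
  have "Ck_on k S (\<lambda>x. frechet_derivative g (at x) v)" for v
  proof (rule Suc.IH)
    show "Ck_on k S (\<lambda>x. frechet_derivative f (at x) v)" using Suc.prems(1) by simp
  qed (use frechet_derivative_at[OF der] in auto)
  then show ?case using der by (auto simp: differentiable_def)
qed

text \<open>The derivative in \<^const>\<open>Ck_on\<close> is the junk value of a choice operator unless it exists, so
  each computation of a derivative is routed through this rule.\<close>

lemma Ck_on_SucI:
  assumes "open S" "\<And>x. x \<in> S \<Longrightarrow> (f has_derivative f' x) (at x)"
    "\<And>v. Ck_on k S (\<lambda>x. f' x v)"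
  shows "Ck_on (Suc k) S f"
proof -
  have "Ck_on k S (\<lambda>x. frechet_derivative f (at x) v)" for v
    using assms(1) assms(3)[of v] by (rule Ck_on_cong) (use frechet_derivative_at[OF assms(2)] in auto)
  then show ?thesis using assms(2) by (auto simp: differentiable_def)
qed

lemma Ck_on_SucD:
  assumes "Ck_on (Suc k) S f"
  shows "\<And>x. x \<in> S \<Longrightarrow> (f has_derivative frechet_derivative f (at x)) (at x)"
    and "Ck_on k S (\<lambda>x. frechet_derivative f (at x) v)"
  using assms by (auto simp: frechet_derivative_works)

text \<open>Lowers the order of factors that stay undifferentiated in the product and chain
  rules.\<close>

lemma Ck_on_Suc_imp: "Ck_on (Suc k) S f \<Longrightarrow> Ck_on k S f"
proof (induction k arbitrary: f)
  case 0
  then show ?case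
    by (auto intro!: continuous_at_imp_continuous_on differentiable_imp_continuous_within)
next
  case (Suc k)
  then show ?case by (metis Ck_on.simps(2))
qed

text \<open>Each condition at a point of \<open>S\<close> follows from an open neighbourhood of it.
  This permits changing the target chart from point to point.\<close>

lemma Ck_on_local:
  assumes "\<And>x. x \<in> S \<Longrightarrow> \<exists>T. open T \<and> x \<in> T \<and> Ck_on k T f"
  shows "Ck_on k S f"
  using assms
proof (induction k arbitrary: f)
  case 0
  then show ?case
    by (metis Ck_on.simps(1) continuous_at_imp_continuous_on continuous_on_eq_continuous_at)
next
  case (Suc k)
  show ?case
    unfolding Ck_on.simps
  proof (intro conjI ballI allI)
    fix x assume "x \<in> S"
    then show "f differentiable (at x)" using Suc.prems by fastforce
  next
    fix v show "Ck_on k S (\<lambda>x. frechet_derivative f (at x) v)"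
    proof (rule Suc.IH)
      fix x assume "x \<in> S"
      then show "\<exists>T. open T \<and> x \<in> T \<and> Ck_on k T (\<lambda>x. frechet_derivative f (at x) v)"
        using Suc.prems by fastforce
    qed
  qed
qed

lemma Ck_on_add:
  assumes "open S" "Ck_on k S f" "Ck_on k S g"
  shows "Ck_on k S (\<lambda>x. f x + g x)"
  using assms(2,3)
proof (induction k arbitrary: f g)
  case 0
  then show ?case by (auto intro: continuous_intros)
next
  case (Suc k)
  show ?case
  proof (rule Ck_on_SucI[OF assms(1)])
    fix x assume "x \<in> S"
    then show "((\<lambda>x. f x + g x) has_derivative
        (\<lambda>v. frechet_derivative f (at x) v + frechet_derivative g (at x) v)) (at x)"
      using Suc.prems by (intro has_derivative_add Ck_on_SucD)
  qed (intro Suc.IH Ck_on_SucD Suc.prems)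
qed

lemma Ck_on_const: "Ck_on k S (\<lambda>x. c)"
  by (induction k arbitrary: c) auto

lemma Ck_on_sum:
  assumes "open S" "finite I" "\<And>i. i \<in> I \<Longrightarrow> Ck_on k S (f i)"
  shows "Ck_on k S (\<lambda>x. \<Sum>i\<in>I. f i x)"
  using assms(2,3)
  by (induction I rule: finite_induct) (auto intro: Ck_on_add[OF assms(1)] Ck_on_const)

lemma Ck_on_mult:
  fixes f g :: "'a::real_normed_vector \<Rightarrow> real"
  assumes "open S" "Ck_on k S f" "Ck_on k S g"
  shows "Ck_on k S (\<lambda>x. f x * g x)"
  using assms(2,3)
proof (induction k arbitrary: f g)
  case 0
  then show ?case by (auto intro: continuous_intros)
next
  case (Suc k)
  show ?case
  proof (rule Ck_on_SucI[OF assms(1)])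
    fix x assume "x \<in> S"
    then show "((\<lambda>x. f x * g x) has_derivative
        (\<lambda>v. f x * frechet_derivative g (at x) v + frechet_derivative f (at x) v * g x)) (at x)"
      using Suc.prems by (intro has_derivative_mult Ck_on_SucD)
  qed (intro Suc.IH Ck_on_add[OF assms(1)] Ck_on_SucD Suc.prems Suc.prems[THEN Ck_on_Suc_imp])
qed

lemma Ck_on_bounded_linear:
  assumes "open S" "bounded_linear L" "Ck_on k S f"
  shows "Ck_on k S (\<lambda>x. L (f x))"
  using assms(3)
proof (induction k arbitrary: f)
  case 0
  then show ?case using bounded_linear.continuous_on[OF assms(2)] by auto
next
  case (Suc k)
  show ?case
  proof (rule Ck_on_SucI[OF assms(1)])
    fix x assume "x \<in> S"
    then show "((\<lambda>x. L (f x)) has_derivative (\<lambda>v. L (frechet_derivative f (at x) v))) (at x)"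
      using Suc.prems by (intro bounded_linear.has_derivative[OF assms(2)] Ck_on_SucD)
  qed (intro Suc.IH Ck_on_SucD Suc.prems)
qed

text \<open>The inner derivative is the constant map \<open>L\<close>, so differentiating along
  \<open>v\<close> gives the derivative of \<open>f\<close> along \<open>L v\<close>, composed with
  the same affine map. Unlike in \<open>Ck_on_compose\<close>, \<open>f\<close> may be
  vector-valued, as chart expressions of maps are.\<close>

lemma Ck_on_compose_affine:
  assumes "open T" "bounded_linear L" "\<And>x. x \<in> T \<Longrightarrow> L x + c \<in> S" "Ck_on k S f"
  shows "Ck_on k T (\<lambda>x. f (L x + c))"
  using assms(4)
proof (induction k arbitrary: f)
  case 0
  have "continuous_on T (\<lambda>x. L x + c)"
    using bounded_linear.continuous_on[OF assms(2) continuous_on_id] by (intro continuous_intros)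
  then show ?case using 0 assms(3) by (auto intro: continuous_on_compose2)
next
  case (Suc k)
  show ?case
  proof (rule Ck_on_SucI[OF assms(1)])
    fix x assume "x \<in> T"
    have "((\<lambda>x. L x + c) has_derivative L) (at x)"
      using has_derivative_add_const[OF bounded_linear_imp_has_derivative[OF assms(2)]] .
    from has_derivative_compose[OF this Ck_on_SucD(1)[OF Suc.prems assms(3)[OF \<open>x \<in> T\<close>]]]
    show "((\<lambda>x. f (L x + c)) has_derivative (\<lambda>v. frechet_derivative f (at (L x + c)) (L v))) (at x)" .
  qed (intro Suc.IH Ck_on_SucD Suc.prems)
qed

section \<open>Orthonormal coordinates and the chain rule\<close>

lemma orthonormal_expansion:
  fixes B :: "'e::real_inner set"
  assumes "finite B" "\<And>b c. b \<in> B \<Longrightarrow> c \<in> B \<Longrightarrow> b \<bullet> c = (if b = c then 1 else 0)" "span B = UNIV"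
  shows "x = (\<Sum>b\<in>B. (x \<bullet> b) *\<^sub>R b)"
proof -
  have "x \<in> span B" using assms(3) by simp
  then obtain u where u: "x = (\<Sum>b\<in>B. u b *\<^sub>R b)"
    by (auto simp: span_finite[OF assms(1)])
  have "x \<bullet> c = u c" if "c \<in> B" for c
    using that by (simp add: u inner_sum_left assms(1,2) if_distrib cong: if_cong)
  then show ?thesis using u by simp
qed

lemma linear_orthonormal_expansion:
  fixes B :: "'e::real_inner set" and L :: "'e \<Rightarrow> real"
  assumes "finite B" "\<And>b c. b \<in> B \<Longrightarrow> c \<in> B \<Longrightarrow> b \<bullet> c = (if b = c then 1 else 0)" "span B = UNIV"
    and "linear L"
  shows "L w = (\<Sum>b\<in>B. (w \<bullet> b) * L b)"
proof -
  have "L w = L (\<Sum>b\<in>B. (w \<bullet> b) *\<^sub>R b)"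
    using orthonormal_expansion[OF assms(1-3), of w] by simp
  also have "\<dots> = (\<Sum>b\<in>B. (w \<bullet> b) * L b)"
    by (simp add: linear_sum[OF assms(4)] linear_scale[OF assms(4)])
  finally show ?thesis .
qed

text \<open>In the derivative \<open>?f' (g x) (?g' x v)\<close> the direction itself varies with
  \<open>x\<close>, so induction does not apply directly. Expanding that direction in
  \<open>B\<close> leaves products of a coordinate of \<open>?g' x v\<close> with a derivative of
  \<open>f\<close> in a fixed direction, composed with \<open>g\<close>.\<close>

lemma Ck_on_compose:
  fixes B :: "'e::real_inner set" and f :: "'e \<Rightarrow> real"
  assumes B: "finite B" "\<And>b c. b \<in> B \<Longrightarrow> c \<in> B \<Longrightarrow> b \<bullet> c = (if b = c then 1 else 0)" "span B = UNIV"
    and T: "open T" "\<And>x. x \<in> T \<Longrightarrow> g x \<in> S"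
    and "Ck_on k S f" "Ck_on k T g"
  shows "Ck_on k T (\<lambda>x. f (g x))"
  using assms(6,7)
proof (induction k arbitrary: f)
  case 0
  then show ?case using T(2) by (auto intro: continuous_on_compose2)
next
  case (Suc k)
  let ?f' = "\<lambda>z. frechet_derivative f (at z)" and ?g' = "\<lambda>x. frechet_derivative g (at x)"
  show ?case
  proof (rule Ck_on_SucI[OF T(1)])
    fix x assume x: "x \<in> T"
    have f': "(f has_derivative ?f' (g x)) (at (g x))" using Ck_on_SucD(1)[OF Suc.prems(1) T(2)[OF x]] .
    have lin: "linear (?f' (g x))" using f' by (rule has_derivative_linear)
    have "(\<lambda>v. ?f' (g x) (?g' x v)) = (\<lambda>v. \<Sum>b\<in>B. (?g' x v \<bullet> b) * ?f' (g x) b)"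
      by (intro ext linear_orthonormal_expansion[OF B lin])
    then show "((\<lambda>x. f (g x)) has_derivative (\<lambda>v. \<Sum>b\<in>B. (?g' x v \<bullet> b) * ?f' (g x) b)) (at x)"
      using has_derivative_compose[OF Ck_on_SucD(1)[OF Suc.prems(2) x] f'] by argo
  next
    fix v
    \<comment> \<open>The induction hypothesis is applied to the derivative of \<open>f\<close>
      along \<open>b\<close>, with the same \<open>g\<close> lowered by one order.\<close>
    have "Ck_on k T (\<lambda>x. ?f' (g x) b)" for b
      by (rule Suc.IH) (intro Ck_on_SucD Suc.prems Suc.prems(2)[THEN Ck_on_Suc_imp])+
    moreover have "Ck_on k T (\<lambda>x. ?g' x v \<bullet> b)" for b
      by (rule Ck_on_bounded_linear[OF T(1) bounded_linear_inner_left]) (intro Ck_on_SucD Suc.prems)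
    ultimately show "Ck_on k T (\<lambda>x. \<Sum>b\<in>B. (?g' x v \<bullet> b) * ?f' (g x) b)"
      by (intro Ck_on_sum Ck_on_mult T(1) B(1))
  qed
qed

section \<open>Smooth maps and tangent vectors\<close>

lemma smooth_manifold_chart:
  assumes "smooth_manifold M" "(D, \<phi>) \<in> atlas M"
  shows "openin (topol M) D" "D \<subseteq> points M" "inj_on \<phi> D"
    and "openin (topol M) A \<Longrightarrow> A \<subseteq> D \<Longrightarrow> open (\<phi> ` A)"
proof -
  show D: "openin (topol M) D"
    using assms unfolding smooth_manifold_def by fastforce
  then show D': "D \<subseteq> points M" by (rule openin_subset)
  have *: "open (\<phi> ` D)" "homeomorphic_map (subtopology (topol M) D) (top_of_set (\<phi> ` D)) \<phi>"
    using assms unfolding smooth_manifold_def by fastforce+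
  show "inj_on \<phi> D"
    using homeomorphic_imp_injective_map[OF *(2)] D' by (simp add: Int_absorb1)
  assume A: "openin (topol M) A" "A \<subseteq> D"
  then have "openin (subtopology (topol M) D) A" by (simp add: openin_open_subtopology D)
  then have "openin (top_of_set (\<phi> ` D)) (\<phi> ` A)"
    using homeomorphic_imp_open_map[OF *(2)] by (simp add: open_map_def)
  then show "open (\<phi> ` A)" using *(1) by (simp add: openin_open_eq)
qed

lemma smooth_manifold_chart_at:
  assumes "smooth_manifold M" "p \<in> points M"
  obtains D \<phi> where "(D, \<phi>) \<in> atlas M" "p \<in> D"
proof -
  have "(\<Union>(D, \<phi>)\<in>atlas M. D) = points M"
    using assms(1) unfolding smooth_manifold_def by (elim conjE)
  with assms(2) have "p \<in> (\<Union>(D, \<phi>)\<in>atlas M. D)" by (simp only:)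
  then show thesis using that by auto
qed

text \<open>The preimage is taken over the whole type, and \<open>F\<close> is uncontrolled outside
  \<open>points M\<close>; intersecting with \<open>D\<close> discards that part.\<close>

lemma openin_chart_preimage:
  assumes "smooth_manifold M" "(D, \<phi>) \<in> atlas M" "continuous_map (topol M) (topol N) F"
    "openin (topol N) E"
  shows "openin (topol M) (D \<inter> F -` E)"
proof -
  have "D \<inter> F -` E = D \<inter> {x \<in> points M. F x \<in> E}"
    using smooth_manifold_chart(2)[OF assms(1,2)] by auto
  then show ?thesis
    using smooth_manifold_chart(1)[OF assms(1,2)] openin_continuous_map_preimage[OF assms(3,4)] by auto
qed

text \<open>Chart domains lie in \<open>points M\<close>, so the restriction that makes a function
  extensional is invisible in coordinates.\<close>

lemma smooth_functions_restrictI: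
  assumes M: "smooth_manifold M"
    and r: "\<And>D \<phi> k. (D, \<phi>) \<in> atlas M \<Longrightarrow> Ck_on k (\<phi> ` D) (\<lambda>x. r (inv_into D \<phi> x))"
  shows "restrict r (points M) \<in> smooth_functions M"
proof -
  have "Ck_on k (\<phi> ` D) (restrict r (points M) \<circ> inv_into D \<phi>)" if D: "(D, \<phi>) \<in> atlas M" for D \<phi> k
  proof -
    note chart = smooth_manifold_chart[OF M D]
    have "open (\<phi> ` D)" using chart(1,4) by blast
    then show ?thesis using r[OF D] by (rule Ck_on_cong) (use chart(2,3) in auto)
  qed
  then show ?thesis by (auto simp: smooth_functions_def smooth_on_def)
qed

text \<open>A chart of \<open>N\<close> need not contain the image of a whole chart domain of
  \<open>M\<close>, so a chart at \<open>F p\<close> is chosen for each \<open>p\<close> and the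
  results are glued.\<close>

lemma smooth_functions_compose:
  fixes M :: "('p, 'e::real_inner) manifold" and N :: "('q, 'f::real_inner) manifold"
  assumes M: "smooth_manifold M" and N: "smooth_manifold N" and F: "smooth_map M N F"
    and f: "f \<in> smooth_functions N"
  shows "(\<lambda>x\<in>points M. f (F x)) \<in> smooth_functions M"
proof -
  obtain B :: "'f set" where B: "finite B"
    "\<forall>b\<in>B. \<forall>c\<in>B. b \<bullet> c = (if b = c then 1 else 0)" "span B = UNIV"
    using N[unfolded smooth_manifold_def, THEN conjunct1] by (elim exE conjE)
  have cont: "continuous_map (topol M) (topol N) F" using F by (simp add: smooth_map_def)
  show ?thesis
  proof (rule smooth_functions_restrictI[OF M], rule Ck_on_local)
    fix D \<phi> k z assume D: "(D, \<phi>) \<in> atlas M" and "z \<in> \<phi> ` D"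
    then obtain p where p: "p \<in> D" "z = \<phi> p" by auto
    note chart = smooth_manifold_chart[OF M D]
    have "F p \<in> points N"
      using cont p(1) chart(2) continuous_map_image_subset_topspace by blast
    then obtain E \<psi> where E: "(E, \<psi>) \<in> atlas N" "F p \<in> E"
      by (rule smooth_manifold_chart_at[OF N])
    let ?T = "\<phi> ` (D \<inter> F -` E)"
    have "open ?T"
      using openin_chart_preimage[OF M D cont smooth_manifold_chart(1)[OF N E(1)]] chart(4) by blast
    moreover have "Ck_on k ?T (\<lambda>x. f (F (inv_into D \<phi> x)))"
    proof (rule Ck_on_cong[OF \<open>open ?T\<close>])
      \<comment> \<open>Since \<open>inv_into E \<psi>\<close> undoes \<open>\<psi>\<close> on
        \<open>E\<close>, inserting both splits the function into the coordinate forms of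
        \<open>f\<close> and \<open>F\<close>.\<close>
      show "Ck_on k ?T (\<lambda>x. (f \<circ> inv_into E \<psi>) ((\<psi> \<circ> F \<circ> inv_into D \<phi>) x))"
      proof (rule Ck_on_compose[OF B(1) B(2)[rule_format] B(3) \<open>open ?T\<close>])
        show "(\<psi> \<circ> F \<circ> inv_into D \<phi>) x \<in> \<psi> ` E" if "x \<in> ?T" for x
          using that chart(3) by auto
        show "Ck_on k (\<psi> ` E) (f \<circ> inv_into E \<psi>)"
          using f E(1) by (auto simp: smooth_functions_def smooth_on_def)
        show "Ck_on k ?T (\<psi> \<circ> F \<circ> inv_into D \<phi>)"
          using F D E(1) by (fastforce simp: smooth_map_def smooth_on_def)
      qed
      show "(f \<circ> inv_into E \<psi>) ((\<psi> \<circ> F \<circ> inv_into D \<phi>) x) = f (F (inv_into D \<phi> x))" if "x \<in> ?T" for x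
        using that chart(2,3) smooth_manifold_chart(3)[OF N E(1)] by auto
    qed
    ultimately show "\<exists>T. open T \<and> z \<in> T \<and> Ck_on k T (\<lambda>x. f (F (inv_into D \<phi> x)))"
      using p E(2) by (intro exI[of _ ?T]) auto
  qed
qed

section \<open>Slices of smooth maps on a product\<close>

lemma inv_into_map_prod:
  assumes "inj_on f A" "inj_on g B" "a \<in> A" "b \<in> B"
  shows "inv_into (A \<times> B) (map_prod f g) (f a, g b) = (a, b)"
  using inv_into_f_f[OF map_prod_inj_on[OF assms(1,2)], of "(a, b)"] assms(3,4) by simp

text \<open>In a product chart whose second factor is a chart at \<open>c\<close>, the embedding of
  the slice is the affine map \<open>(x, 0) + (0, \<theta> c)\<close>. Applied to the
  multiplication, this yields right translations.\<close>

lemma smooth_map_fix_snd: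
  assumes M: "smooth_manifold M" and N: "smooth_manifold N" and P: "smooth_manifold P"
    and F: "smooth_map (prod_manifold M N) P F" and c: "c \<in> points N"
  shows "smooth_map M P (\<lambda>x. F (x, c))"
proof -
  have cont: "continuous_map (topol M) (topol P) (\<lambda>x. F (x, c))"
  proof -
    have "continuous_map (topol M) (prod_topology (topol M) (topol N)) (\<lambda>x. (x, c))"
      using c by (simp add: continuous_map_pairedI)
    then show ?thesis
      using F continuous_map_compose by (fastforce simp: smooth_map_def prod_manifold_def o_def)
  qed
  have "Ck_on k (\<phi> ` (D \<inter> (\<lambda>x. F (x, c)) -` E)) (\<psi> \<circ> (\<lambda>x. F (x, c)) \<circ> inv_into D \<phi>)"
    if D: "(D, \<phi>) \<in> atlas M" and E: "(E, \<psi>) \<in> atlas P" for D \<phi> E \<psi> k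
  proof -
    obtain C \<theta> where C: "(C, \<theta>) \<in> atlas N" "c \<in> C" using smooth_manifold_chart_at[OF N c] .
    note inv = inv_into_map_prod[OF smooth_manifold_chart(3)[OF M D] smooth_manifold_chart(3)[OF N C(1)]]
    let ?T = "\<phi> ` (D \<inter> (\<lambda>x. F (x, c)) -` E)" and ?S = "map_prod \<phi> \<theta> ` (D \<times> C \<inter> F -` E)"
    let ?f = "\<psi> \<circ> F \<circ> inv_into (D \<times> C) (map_prod \<phi> \<theta>)"
    have T: "open ?T"
      using openin_chart_preimage[OF M D cont smooth_manifold_chart(1)[OF P E]]
        smooth_manifold_chart(4)[OF M D] by blast
    have "(D \<times> C, map_prod \<phi> \<theta>) \<in> atlas (prod_manifold M N)"
      using D C by (auto simp: prod_manifold_def)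
    then have f: "Ck_on k ?S ?f"
      using F E by (fastforce simp: smooth_map_def smooth_on_def)
    have "Ck_on k ?T (\<lambda>x. ?f ((x, 0) + (0, \<theta> c)))"
    proof (rule Ck_on_compose_affine[OF T _ _ f])
      show "bounded_linear (\<lambda>x::'b. (x, 0::'d))"
        by (intro bounded_linear_Pair bounded_linear_ident bounded_linear_zero)
    qed (use C(2) in force)
    then show ?thesis
      by (rule Ck_on_cong[OF T]) (use C(2) smooth_manifold_chart(3)[OF M D] in \<open>auto simp: inv\<close>)
  qed
  with cont show ?thesis by (auto simp: smooth_map_def smooth_on_def)
qed

text \<open>The mirror image, which yields left translations.\<close>

lemma smooth_map_fix_fst:
  assumes M: "smooth_manifold M" and N: "smooth_manifold N" and P: "smooth_manifold P"
    and F: "smooth_map (prod_manifold M N) P F" and c: "c \<in> points M"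
  shows "smooth_map N P (\<lambda>x. F (c, x))"
proof -
  have cont: "continuous_map (topol N) (topol P) (\<lambda>x. F (c, x))"
  proof -
    have "continuous_map (topol N) (prod_topology (topol M) (topol N)) (\<lambda>x. (c, x))"
      using c by (simp add: continuous_map_pairedI)
    then show ?thesis
      using F continuous_map_compose by (fastforce simp: smooth_map_def prod_manifold_def o_def)
  qed
  have "Ck_on k (\<phi> ` (D \<inter> (\<lambda>x. F (c, x)) -` E)) (\<psi> \<circ> (\<lambda>x. F (c, x)) \<circ> inv_into D \<phi>)"
    if D: "(D, \<phi>) \<in> atlas N" and E: "(E, \<psi>) \<in> atlas P" for D \<phi> E \<psi> k
  proof -
    obtain C \<theta> where C: "(C, \<theta>) \<in> atlas M" "c \<in> C" using smooth_manifold_chart_at[OF M c] .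
    note inv = inv_into_map_prod[OF smooth_manifold_chart(3)[OF M C(1)] smooth_manifold_chart(3)[OF N D]]
    let ?T = "\<phi> ` (D \<inter> (\<lambda>x. F (c, x)) -` E)" and ?S = "map_prod \<theta> \<phi> ` (C \<times> D \<inter> F -` E)"
    let ?f = "\<psi> \<circ> F \<circ> inv_into (C \<times> D) (map_prod \<theta> \<phi>)"
    have T: "open ?T"
      using openin_chart_preimage[OF N D cont smooth_manifold_chart(1)[OF P E]]
        smooth_manifold_chart(4)[OF N D] by blast
    have "(C \<times> D, map_prod \<theta> \<phi>) \<in> atlas (prod_manifold M N)"
      using D C by (auto simp: prod_manifold_def)
    then have f: "Ck_on k ?S ?f"
      using F E by (fastforce simp: smooth_map_def smooth_on_def)
    have "Ck_on k ?T (\<lambda>x. ?f ((0, x) + (\<theta> c, 0)))"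
    proof (rule Ck_on_compose_affine[OF T _ _ f])
      show "bounded_linear (\<lambda>x::'d. (0::'b, x))"
        by (intro bounded_linear_Pair bounded_linear_ident bounded_linear_zero)
    qed (use C(2) in force)
    then show ?thesis
      by (rule Ck_on_cong[OF T]) (use C(2) smooth_manifold_chart(3)[OF N D] in \<open>auto simp: inv\<close>)
  qed
  with cont show ?thesis by (auto simp: smooth_map_def smooth_on_def)
qed

section \<open>The algebra of smooth functions and the pushforward of tangent vectors\<close>

lemma smooth_map_points: "smooth_map M N F \<Longrightarrow> x \<in> points M \<Longrightarrow> F x \<in> points N"
  unfolding smooth_map_def using continuous_map_image_subset_topspace by blast

text \<open>A pushforward is \<open>undefined\<close> off the smooth functions, so its derivation
  rules can be checked only once sums, products and multiples are known to be smooth.\<close>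

lemma smooth_functions_closed:
  assumes M: "smooth_manifold M" and f: "f \<in> smooth_functions M"
  shows "h \<in> smooth_functions M \<Longrightarrow> (\<lambda>x\<in>points M. f x + h x) \<in> smooth_functions M"
    and "h \<in> smooth_functions M \<Longrightarrow> (\<lambda>x\<in>points M. f x * h x) \<in> smooth_functions M"
    and "(\<lambda>x\<in>points M. c * f x) \<in> smooth_functions M"
proof -
  have T: "open (\<phi> ` D)" if "(D, \<phi>) \<in> atlas M" for D \<phi>
    using smooth_manifold_chart(1,4)[OF M that] by blast
  have coord: "Ck_on k (\<phi> ` D) (\<lambda>x. r (inv_into D \<phi> x))"
    if "r \<in> smooth_functions M" "(D, \<phi>) \<in> atlas M" for r D \<phi> k
    using that by (fastforce simp: smooth_functions_def smooth_on_def o_def)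
  show "(\<lambda>x\<in>points M. c * f x) \<in> smooth_functions M"
    by (intro smooth_functions_restrictI[OF M] Ck_on_mult T Ck_on_const coord f)
  assume h: "h \<in> smooth_functions M"
  show "(\<lambda>x\<in>points M. f x + h x) \<in> smooth_functions M"
    by (intro smooth_functions_restrictI[OF M] Ck_on_add T coord f h)
  show "(\<lambda>x\<in>points M. f x * h x) \<in> smooth_functions M"
    by (intro smooth_functions_restrictI[OF M] Ck_on_mult T coord f h)
qed

text \<open>Composition with \<open>F\<close> respects sums, multiples and products, and turns
  evaluation at \<open>p\<close> into evaluation at \<open>F p\<close>; hence it transports
  derivations.\<close>

lemma pushforward_in_tangent_space:
  assumes M: "smooth_manifold M" and N: "smooth_manifold N" and F: "smooth_map M N F"
    and p: "p \<in> points M" and X: "X \<in> tangent_space M p"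
  shows "pushforward M N F X \<in> tangent_space N (F p)"
proof -
  let ?c = "\<lambda>f. \<lambda>x\<in>points M. f (F x)"
  have c: "?c f \<in> smooth_functions M" if "f \<in> smooth_functions N" for f
    using smooth_functions_compose[OF M N F that] .
  have X': "X (\<lambda>x\<in>points M. f (F x) + h (F x)) = X (?c f) + X (?c h)"
    "X (\<lambda>x\<in>points M. f (F x) * h (F x)) = f (F p) * X (?c h) + X (?c f) * h (F p)"
    if "f \<in> smooth_functions N" "h \<in> smooth_functions N" for f h
  proof -
    \<comment> \<open>The rules for \<open>X\<close> speak of the restricted functions
      \<open>?c f\<close>; inside \<open>points M\<close> the inner restrictions disappear, and
      \<open>p\<close> lies there.\<close>
    have "X (\<lambda>x\<in>points M. ?c f x + ?c h x) = X (?c f) + X (?c h)"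
      "X (\<lambda>x\<in>points M. ?c f x * ?c h x) = ?c f p * X (?c h) + X (?c f) * ?c h p"
      using X c[OF that(1)] c[OF that(2)] unfolding tangent_space_def by blast+
    then show "X (\<lambda>x\<in>points M. f (F x) + h (F x)) = X (?c f) + X (?c h)"
      "X (\<lambda>x\<in>points M. f (F x) * h (F x)) = f (F p) * X (?c h) + X (?c f) * h (F p)"
      using p by (simp_all cong: restrict_cong)
  qed
  have X'': "X (\<lambda>x\<in>points M. a * f (F x)) = a * X (?c f)" if "f \<in> smooth_functions N" for f a
  proof -
    have "X (\<lambda>x\<in>points M. a * ?c f x) = a * X (?c f)"
      using X c[OF that] unfolding tangent_space_def by blast
    then show ?thesis by (simp cong: restrict_cong)
  qed
  show ?thesis
    using smooth_functions_closed[OF N]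
    by (simp add: tangent_space_def pushforward_def smooth_map_points[OF F] X' X'' cong: restrict_cong)
qed

text \<open>Smoothness of \<open>F\<close> ensures that the inner pushforward is evaluated at a
  smooth function, where it is not \<open>undefined\<close>.\<close>

lemma pushforward_pushforward:
  assumes "smooth_manifold N" "smooth_manifold P" "smooth_map N P F"
    and H: "\<And>x. x \<in> points M \<Longrightarrow> H x \<in> points N"
  shows "pushforward N P F (pushforward M N H X) = pushforward M P (\<lambda>x. F (H x)) X"
proof
  fix f :: "'c \<Rightarrow> real"
  have "(\<lambda>x\<in>points M. (\<lambda>x\<in>points N. f (F x)) (H x)) = (\<lambda>x\<in>points M. f (F (H x)))"
    by (simp add: H cong: restrict_cong)
  then show "pushforward N P F (pushforward M N H X) f = pushforward M P (\<lambda>x. F (H x)) X f"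
    using smooth_functions_compose[OF assms(1-3)] by (simp add: pushforward_def)
qed

text \<open>Lets group identities valid only on the carrier be used inside a pushforward.\<close>

lemma pushforward_cong:
  assumes "\<And>x. x \<in> points M \<Longrightarrow> F x = H x"
  shows "pushforward M N F = pushforward M N H"
  using assms by (simp add: pushforward_def[abs_def] cong: restrict_cong)

section \<open>The adjoint representation\<close>

lemma lie_groupD:
  assumes "lie_group G M"
  shows "group G" "smooth_manifold M" "points M = carrier G"
  using assms by (auto simp: lie_group_def)

lemma smooth_map_translations:
  assumes "lie_group G M" "g \<in> carrier G"
  shows "smooth_map M M (\<lambda>x. x \<otimes>\<^bsub>G\<^esub> g)" "smooth_map M M (\<lambda>x. g \<otimes>\<^bsub>G\<^esub> x)"
proof -
  have "smooth_map (prod_manifold M M) M (\<lambda>(x, y). x \<otimes>\<^bsub>G\<^esub> y)" "g \<in> points M"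
    using assms by (auto simp: lie_group_def)
  note * = smooth_map_fix_snd[OF _ _ _ this] smooth_map_fix_fst[OF _ _ _ this]
  show "smooth_map M M (\<lambda>x. x \<otimes>\<^bsub>G\<^esub> g)" "smooth_map M M (\<lambda>x. g \<otimes>\<^bsub>G\<^esub> x)"
    using * lie_groupD(2)[OF assms(1)] by auto
qed

text \<open>With \<open>H\<close> general, these rules rewrite a chain of translations into a single
  pushforward, one translation at a time.\<close>

lemma pushforward_translations:
  assumes G: "lie_group G M" and g: "g \<in> carrier G"
    and H: "\<And>x. x \<in> carrier G \<Longrightarrow> H x \<in> carrier G"
  shows "pushforward M M (\<lambda>x. x \<otimes>\<^bsub>G\<^esub> g) (pushforward M M H X) = pushforward M M (\<lambda>x. H x \<otimes>\<^bsub>G\<^esub> g) X"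
    and "pushforward M M (\<lambda>x. g \<otimes>\<^bsub>G\<^esub> x) (pushforward M M H X) = pushforward M M (\<lambda>x. g \<otimes>\<^bsub>G\<^esub> H x) X"
  using lie_groupD[OF G] H
  by (auto intro!: pushforward_pushforward[of M M] smooth_map_translations[OF G g])

text \<open>Splits conjugation into translations, whose smoothness is already known.\<close>

lemma Ad_eq:
  assumes G: "lie_group G M" and g: "g \<in> carrier G"
  shows "Ad G M g \<xi> =
    pushforward M M (\<lambda>x. x \<otimes>\<^bsub>G\<^esub> inv\<^bsub>G\<^esub> g) (pushforward M M (\<lambda>x. g \<otimes>\<^bsub>G\<^esub> x) \<xi>)"
proof -
  interpret group G using lie_groupD(1)[OF G] .
  show ?thesis using g by (simp add: Ad_def pushforward_translations[OF G])
qed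

text \<open>Left translation moves the vector from the identity to \<open>g\<close>, and right
  translation by the inverse moves it back.\<close>

lemma Ad_in_lie_algebra:
  assumes G: "lie_group G M" and g: "g \<in> carrier G" and \<xi>: "\<xi> \<in> lie_algebra G M"
  shows "Ad G M g \<xi> \<in> lie_algebra G M"
proof -
  interpret group G using lie_groupD(1)[OF G] .
  note M = lie_groupD(2)[OF G] and pts = lie_groupD(3)[OF G]
  have L: "pushforward M M (\<lambda>x. g \<otimes>\<^bsub>G\<^esub> x) \<xi> \<in> tangent_space M g"
    using pushforward_in_tangent_space[OF M M smooth_map_translations(2)[OF G g] _ \<xi>] pts g by simp
  show ?thesis
    unfolding Ad_eq[OF G g]
    using pushforward_in_tangent_space[OF M M smooth_map_translations(1)[OF G inv_closed[OF g]] _ L] pts g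
    by simp
qed

text \<open>Turns the admissibility relation between group products into one between nested adjoint
  operators.\<close>

lemma Ad_mult:
  assumes G: "lie_group G M" and g: "g \<in> carrier G" and h: "h \<in> carrier G"
  shows "Ad G M g (Ad G M h \<xi>) = Ad G M (g \<otimes>\<^bsub>G\<^esub> h) \<xi>"
proof -
  interpret group G using lie_groupD(1)[OF G] .
  have "Ad G M g (Ad G M h \<xi>) = pushforward M M
      (\<lambda>x. g \<otimes>\<^bsub>G\<^esub> (h \<otimes>\<^bsub>G\<^esub> x \<otimes>\<^bsub>G\<^esub> inv\<^bsub>G\<^esub> h) \<otimes>\<^bsub>G\<^esub> inv\<^bsub>G\<^esub> g) \<xi>"
    unfolding Ad_eq[OF G g] using g h by (simp add: Ad_def pushforward_translations[OF G])
  also have "\<dots> = Ad G M (g \<otimes>\<^bsub>G\<^esub> h) \<xi>"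
    unfolding Ad_def
    by (intro fun_cong[OF pushforward_cong]) (use g h lie_groupD(3)[OF G] in \<open>simp add: inv_mult_group m_assoc\<close>)
  finally show ?thesis .
qed

text \<open>Conjugation by \<open>g\<close> followed by right translation by \<open>g\<close> is
  left translation by \<open>g\<close>. Both sides therefore evaluate \<open>\<alpha>\<close> at the
  same vector, whatever \<open>\<alpha>\<close> is; \<open>Ad_in_lie_algebra\<close> keeps the
  argument inside the domain of the pull-back.\<close>

lemma pull_R_Ad:
  assumes G: "lie_group G M" and g: "g \<in> carrier G" and \<xi>: "\<xi> \<in> lie_algebra G M"
  shows "pull_R G M g \<alpha> (Ad G M g \<xi>) = pull_L G M g \<alpha> \<xi>"
proof -
  interpret group G using lie_groupD(1)[OF G] .
  have "pushforward M M (\<lambda>x. x \<otimes>\<^bsub>G\<^esub> g) (Ad G M g \<xi>) =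
      pushforward M M (\<lambda>x. g \<otimes>\<^bsub>G\<^esub> x \<otimes>\<^bsub>G\<^esub> inv\<^bsub>G\<^esub> g \<otimes>\<^bsub>G\<^esub> g) \<xi>"
    using g by (simp add: Ad_def pushforward_translations[OF G])
  also have "\<dots> = pushforward M M (\<lambda>x. g \<otimes>\<^bsub>G\<^esub> x) \<xi>"
    by (intro fun_cong[OF pushforward_cong]) (use g lie_groupD(3)[OF G] in \<open>simp add: m_assoc\<close>)
  finally show ?thesis
    using Ad_in_lie_algebra[OF G g \<xi>] \<xi> by (simp add: pull_R_def pull_L_def pullback_def)
qed

text \<open>The elimination also draws on the equations at the left and lower neighbours of
  \<open>(i, j)\<close>. These are given at interior vertices only, so the conclusion is asserted
  where both neighbours are interior too.\<close>

theorem theorem4p4: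
  fixes G :: "('g, 'm) monoid_scheme"
    and M :: "('g, 'e::real_inner) manifold"
    and U :: "(int \<times> int) set"
    and l :: "int \<times> int \<Rightarrow> 'g \<times> 'g \<Rightarrow> real"
    and y :: "int \<times> int \<Rightarrow> 'g \<times> 'g"
    and lam :: "int \<times> int \<Rightarrow> (('g \<Rightarrow> real) \<Rightarrow> real) \<Rightarrow> real"
  assumes "lie_group G M"
    and "finite U"
    and "\<And>p. l p \<in> smooth_functions (prod_manifold M M)"
    and "y \<in> sections G (vertices U)"
    and "lam \<in> U \<rightarrow>\<^sub>E lie_coalgebra G M"
    and "admissible G U y"
    and "\<And>i j. (i, j) \<in> interior_vertices U \<Longrightarrow> lagrange_equations_at G M l y lam i j"
  shows "\<And>i j. (i, j) \<in> interior_vertices U \<Longrightarrow>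
           (i - 1, j) \<in> interior_vertices U \<Longrightarrow> (i, j - 1) \<in> interior_vertices U \<Longrightarrow>
           euler_poincare_at G M l y i j"
proof -
  fix i j :: int
  assume int: "(i, j) \<in> interior_vertices U" "(i - 1, j) \<in> interior_vertices U"
    "(i, j - 1) \<in> interior_vertices U"
  interpret group G using lie_groupD(1)[OF assms(1)] .
  define u v where "u p = fst (y p)" and "v p = snd (y p)" for p
  \<comment> \<open>The face at \<open>(i - 1, j - 1)\<close> contains both neighbours, so their
    interiority places it in \<open>U\<close>.\<close>
  have U: "(i - 1, j) \<in> U" "(i, j - 1) \<in> U" "(i - 1, j - 1) \<in> U"
    using int by (auto simp: interior_vertices_def face_def)
  then have "(i - 1, j) \<in> vertices U" "(i, j - 1) \<in> vertices U" "(i - 1, j - 1) \<in> vertices U"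
    by (force simp: vertices_def face_def)+
  then have "y (i - 1, j) \<in> carrier G \<times> carrier G" "y (i, j - 1) \<in> carrier G \<times> carrier G"
    "y (i - 1, j - 1) \<in> carrier G \<times> carrier G"
    using assms(4) unfolding sections_def by blast+
  then have carr: "u (i - 1, j) \<in> carrier G" "v (i - 1, j) \<in> carrier G"
    "u (i, j - 1) \<in> carrier G" "v (i, j - 1) \<in> carrier G"
    "u (i - 1, j - 1) \<in> carrier G" "v (i - 1, j - 1) \<in> carrier G"
    by (auto simp: u_def v_def mem_Times_iff)
  \<comment> \<open>The jet is taken at \<open>(i - 1, j - 1)\<close>, whose other two face vertices
    are exactly the neighbours of \<open>(i, j)\<close>.\<close>
  have "u (i - 1, j - 1) \<otimes>\<^bsub>G\<^esub> v (i, j - 1) \<otimes>\<^bsub>G\<^esub> inv\<^bsub>G\<^esub> u (i - 1, j) \<otimes>\<^bsub>G\<^esub> inv\<^bsub>G\<^esub> v (i - 1, j - 1) = \<one>\<^bsub>G\<^esub>"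
    using assms(6) U(3)
    by (fastforce simp: admissible_def constraint_def jet_def u_def v_def split_beta)
  then have "(u (i - 1, j - 1) \<otimes>\<^bsub>G\<^esub> v (i, j - 1)) \<otimes>\<^bsub>G\<^esub>
      inv\<^bsub>G\<^esub> (v (i - 1, j - 1) \<otimes>\<^bsub>G\<^esub> u (i - 1, j)) = \<one>\<^bsub>G\<^esub>"
    using carr by (simp add: inv_mult_group m_assoc)
  then have adm: "u (i - 1, j - 1) \<otimes>\<^bsub>G\<^esub> v (i, j - 1) = v (i - 1, j - 1) \<otimes>\<^bsub>G\<^esub> u (i - 1, j)"
    using carr by (metis inv_closed inv_equality inv_inv m_closed)
  show "euler_poincare_at G M l y i j"
    unfolding euler_poincare_at_def
  proof
    fix \<xi> assume \<xi>: "\<xi> \<in> lie_algebra G M"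
    note Ad_mem = Ad_in_lie_algebra[OF assms(1) _ \<xi>]
    note eqs = assms(7)[unfolded lagrange_equations_at_def coAd_def, folded u_def v_def]
    \<comment> \<open>\<open>Ad_mem\<close> is used twice: the equation holds only on the Lie
      algebra, and the restricted function \<open>coAd\<close> unfolds only there.\<close>
    have "pull_R G M (u (i - 1, j)) (dl_u M l y (i - 1, j)) (Ad G M (u (i - 1, j)) \<xi>)
        + lam (i - 1, j) (Ad G M (u (i - 1, j)) \<xi>)
        - lam (i - 1, j - 1) (Ad G M (v (i - 1, j - 1)) (Ad G M (u (i - 1, j)) \<xi>)) = 0"
      using eqs[OF int(2)] Ad_mem[OF carr(1)] by simp
    moreover have "pull_R G M (v (i, j - 1)) (dl_v M l y (i, j - 1)) (Ad G M (v (i, j - 1)) \<xi>)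
        - lam (i, j - 1) (Ad G M (v (i, j - 1)) \<xi>)
        + lam (i - 1, j - 1) (Ad G M (u (i - 1, j - 1)) (Ad G M (v (i, j - 1)) \<xi>)) = 0"
      using eqs[OF int(3)] Ad_mem[OF carr(4)] by simp
    moreover have "pull_R G M (u (i, j)) (dl_u M l y (i, j)) \<xi>
        + lam (i, j) \<xi> - lam (i, j - 1) (Ad G M (v (i, j - 1)) \<xi>) = 0"
      and "pull_R G M (v (i, j)) (dl_v M l y (i, j)) \<xi>
        - lam (i, j) \<xi> + lam (i - 1, j) (Ad G M (u (i - 1, j)) \<xi>) = 0"
      using eqs[OF int(1)] \<xi> by simp_all
    ultimately show "pull_R G M (fst (y (i, j))) (dl_u M l y (i, j)) \<xi>
        - pull_L G M (fst (y (i - 1, j))) (dl_u M l y (i - 1, j)) \<xi>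
        + pull_R G M (snd (y (i, j))) (dl_v M l y (i, j)) \<xi>
        - pull_L G M (snd (y (i, j - 1))) (dl_v M l y (i, j - 1)) \<xi> = 0"
      \<comment> \<open>By \<open>Ad_mult\<close> and \<open>adm\<close> both terms in
        \<open>lam (i - 1, j - 1)\<close> have the same argument. The goal is the sum of the two
        equations at \<open>(i, j)\<close> minus the sum of the two at the neighbours.\<close>
      unfolding u_def[symmetric] v_def[symmetric]
      using carr by (simp add: pull_R_Ad[OF assms(1) _ \<xi>] Ad_mult[OF assms(1)] adm)
  qed
qed

end
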